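(* Let $Q$ be a finite quandle. Then the following statements are equivalent: (1) $Q$ is either a trivial quandle or $Q$ is isomorphic to the dihedral quandle $\mathrm{R}_3$; (2) $\mathrm{Aut}(Q)=\Sigma_{|Q|}$, i.e. every permutation of $Q$ is an automorphism of $Q$; (3) $\mathrm{Aut}(Q)$ acts $3$-transitively on $Q$.
   Context: A quandle is a set $Q$ with a binary operation $*$ such that (1) $x*x=x$ for all $x\in Q$; (2) for every $x\in Q$ the map $S_x:y\mapsto y*x$ is a bijection of $Q$; (3) $(x*y)*z=(x*z)*(y*z)$ for all $x,y,z\in Q$. $\mathrm{Aut}(Q)$ is the group of bijections $\varphi$ of $Q$ with $\varphi(x*y)=\varphi(x)*\varphi(y)$ for all $x,y$. A quandle is trivial if $x*y=x$ for all $x,y$. The dihedral quandle $\mathrm{R}_n=\{a_0,\dots,a_{n-1}\}$ has operation $a_i*a_j=a_{2j-i \ (\mathrm{mod}\ n)}$. $\Sigma_{|Q|}$ denotes the full group of permutations of $Q$. A group $G$ acting on a set $X$ acts $k$-transitively, for $k\le |X|$, if for any two $k$-tuples $(x_1,\dots,x_k)$ and $(y_1,\dots,y_k)$ of distinct elements of $X$ there is $g\in G$ with $gx_i=y_i$ for $i=1,\dots,k$. By convention, if $k>|X|$, then any group action on $X$ is called $k$-transitive. *)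

theory Defs
  imports "HOL-Algebra.Group_Action"
begin

record 'a quandle_struct = "'a partial_object" +
  qmult :: "['a, 'a] \<Rightarrow> 'a" (infixl \<open>\<star>\<index>\<close> 70)

locale quandle =
  fixes Q (structure)
  assumes closed: "\<lbrakk>x \<in> carrier Q; y \<in> carrier Q\<rbrakk> \<Longrightarrow> x \<star> y \<in> carrier Q"
    and idem: "x \<in> carrier Q \<Longrightarrow> x \<star> x = x"
    and bij_right: "x \<in> carrier Q \<Longrightarrow> bij_betw (\<lambda>y. y \<star> x) (carrier Q) (carrier Q)"
    and self_distrib: "\<lbrakk>x \<in> carrier Q; y \<in> carrier Q; z \<in> carrier Q\<rbrakk> \<Longrightarrow>
      (x \<star> y) \<star> z = (x \<star> z) \<star> (y \<star> z)"

locale finite_quandle = quandle +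
  assumes finite_carrier: "finite (carrier Q)"

locale trivial_quandle = quandle +
  assumes trivial: "\<lbrakk>x \<in> carrier Q; y \<in> carrier Q\<rbrakk> \<Longrightarrow> x \<star> y = x"

definition quandle_hom ::
  "[('a, 'c) quandle_struct_scheme, ('b, 'd) quandle_struct_scheme] \<Rightarrow> ('a \<Rightarrow> 'b) set"
  where "quandle_hom Q R =
    {h \<in> carrier Q \<rightarrow> carrier R.
      \<forall>x \<in> carrier Q. \<forall>y \<in> carrier Q. h (x \<star>\<^bsub>Q\<^esub> y) = h x \<star>\<^bsub>R\<^esub> h y}"

definition quandle_isomorphic ::
  "[('a, 'c) quandle_struct_scheme, ('b, 'd) quandle_struct_scheme] \<Rightarrow> bool"
  where "quandle_isomorphic Q R \<longleftrightarrow>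
    (\<exists>h \<in> quandle_hom Q R. bij_betw h (carrier Q) (carrier R))"

text \<open>The element \<open>a\<^sub>i\<close> is represented by the integer \<open>i\<close>; integers are used because
  \<open>2 * j - i\<close> may be negative before reduction.\<close>

definition dihedral_quandle :: "nat \<Rightarrow> int quandle_struct"
  where "dihedral_quandle n =
    \<lparr>carrier = {0..<int n}, qmult = \<lambda>i j. (2 * j - i) mod int n\<rparr>"

lemma quandle_dihedral: "quandle (dihedral_quandle n)"
proof
  fix x :: int
  assume x: "x \<in> carrier (dihedral_quandle n)"
  let ?f = "\<lambda>y. y \<star>\<^bsub>dihedral_quandle n\<^esub> x"
  have inv: "?f (?f y) = y" if "y \<in> carrier (dihedral_quandle n)" for y
    using that by (simp add: dihedral_quandle_def mod_simps)
  show "bij_betw ?f (carrier (dihedral_quandle n)) (carrier (dihedral_quandle n))"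
    by (rule bij_betw_byWitness[where f' = ?f])
      (use inv in \<open>auto simp: dihedral_quandle_def\<close>)
next
  fix x y z :: int
  have "(2 * ((2 * z - y) mod int n) - (2 * z - x) mod int n) mod int n =
      (2 * (2 * z - y) - (2 * z - x)) mod int n"
    by (intro mod_diff_cong) (simp_all only: mod_mult_right_eq mod_mod_trivial)
  also have "\<dots> = (2 * z - (2 * y - x) mod int n) mod int n"
    by (simp only: mod_diff_right_eq) (simp add: algebra_simps)
  finally have "(2 * z - (2 * y - x) mod int n) mod int n =
      (2 * ((2 * z - y) mod int n) - (2 * z - x) mod int n) mod int n" ..
  then show "(x \<star>\<^bsub>dihedral_quandle n\<^esub> y) \<star>\<^bsub>dihedral_quandle n\<^esub> z =
      (x \<star>\<^bsub>dihedral_quandle n\<^esub> z) \<star>\<^bsub>dihedral_quandle n\<^esub> (y \<star>\<^bsub>dihedral_quandle n\<^esub> z)"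
    by (simp add: dihedral_quandle_def)
qed (auto simp: dihedral_quandle_def)

text \<open>Following \<^const>\<open>AutoGroup\<close>, automorphisms are functions that are extensional on the
  carrier, so that \<^term>\<open>BijGroup (carrier Q)\<close> is the full permutation group of \<open>Q\<close>.\<close>

definition quandle_auto :: "('a, 'c) quandle_struct_scheme \<Rightarrow> ('a \<Rightarrow> 'a) set"
  where "quandle_auto Q = quandle_hom Q Q \<inter> Bij (carrier Q)"

definition quandle_AutoGroup :: "('a, 'c) quandle_struct_scheme \<Rightarrow> ('a \<Rightarrow> 'a) monoid"
  where "quandle_AutoGroup Q = BijGroup (carrier Q) \<lparr>carrier := quandle_auto Q\<rparr>"

text \<open>If \<open>E\<close> is finite and \<open>k > card E\<close>, there are no distinct lists of length \<open>k\<close> in \<open>E\<close>,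
  so every action is \<open>k\<close>-transitive, as is the convention.\<close>

locale k_transitive_action = group_action +
  fixes k :: nat
  assumes k_transitive:
    "\<lbrakk>length xs = k; distinct xs; set xs \<subseteq> E; length ys = k; distinct ys; set ys \<subseteq> E\<rbrakk> \<Longrightarrow>
      \<exists>g \<in> carrier G. \<forall>i < k. \<phi> g (xs ! i) = ys ! i"

lemma (in quandle) subgroup_quandle_auto:
  "subgroup (quandle_auto Q) (BijGroup (carrier Q))"
proof (rule subgroup.intro)
  show "quandle_auto Q \<subseteq> carrier (BijGroup (carrier Q))"
    by (auto simp: quandle_auto_def BijGroup_def)
next
  fix f g assume "f \<in> quandle_auto Q" "g \<in> quandle_auto Q"
  then show "f \<otimes>\<^bsub>BijGroup (carrier Q)\<^esub> g \<in> quandle_auto Q"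
    by (auto simp: quandle_auto_def quandle_hom_def BijGroup_def compose_Bij closed
        compose_eq Pi_iff)
next
  show "\<one>\<^bsub>BijGroup (carrier Q)\<^esub> \<in> quandle_auto Q"
    by (auto simp: quandle_auto_def quandle_hom_def BijGroup_def id_Bij closed)
next
  fix f assume f: "f \<in> quandle_auto Q"
  then have B: "f \<in> Bij (carrier Q)" by (simp add: quandle_auto_def)
  have "inv_into (carrier Q) f (x \<star> y) = inv_into (carrier Q) f x \<star> inv_into (carrier Q) f y"
    if "x \<in> carrier Q" "y \<in> carrier Q" for x y
    by (rule Bij_inv_into_lemma[where g = "\<lambda>x y. x \<star> y"])
      (use f B that closed in \<open>auto simp: quandle_auto_def quandle_hom_def\<close>)
  then show "inv\<^bsub>BijGroup (carrier Q)\<^esub> f \<in> quandle_auto Q"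
    using B by (auto simp: inv_BijGroup quandle_auto_def quandle_hom_def closed
        Bij_inv_into_mem intro: restrict_inv_into_Bij)
qed

lemma (in quandle) group_action_quandle_AutoGroup:
  "group_action (quandle_AutoGroup Q) (carrier Q) (\<lambda>f. f)"
proof -
  have "group (quandle_AutoGroup Q)"
    by (simp add: quandle_AutoGroup_def subgroup.subgroup_is_group subgroup_quandle_auto
        group_BijGroup)
  moreover have "(\<lambda>f. f) \<in> hom (quandle_AutoGroup Q) (BijGroup (carrier Q))"
    by (auto simp: hom_def quandle_AutoGroup_def quandle_auto_def BijGroup_def)
  ultimately show ?thesis
    by (simp add: group_action_def group_hom_def group_hom_axioms_def group_BijGroup)
qed

end

theory Submission
  imports Defs
begin

text \<open>If \<open>y \<star> x \<noteq> y\<close>, then \<open>x\<close>, \<open>y\<close> and \<open>y \<star> x\<close> are distinct, and an automorphism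
  that fixes \<open>x\<close> and \<open>y\<close> fixes \<open>y \<star> x\<close>; so 3-transitivity leaves no room for a fourth
  element. On three elements, a product of distinct elements that always differs from
  the first factor must be the third element, which determines the quandle and is preserved by
  every bijection.\<close>

text \<open>The complements of \<open>X\<close> and \<open>Y\<close> in the finite set
  \<open>A\<close> have equal size, so some bijection between them can be glued to
  \<open>f\<close>.\<close>

lemma bij_betw_extend_finite:
  assumes "finite A" "X \<subseteq> A" "Y \<subseteq> A" "bij_betw f X Y"
  obtains g where "bij_betw g A A" "\<And>x. x \<in> X \<Longrightarrow> g x = f x"
proof -
  have "finite X" "finite Y"
    using assms finite_subset by blast+
  then have "card (A - X) = card (A - Y)"
    using assms by (simp add: card_Diff_subset bij_betw_same_card)
  then obtain h where h: "bij_betw h (A - X) (A - Y)"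
    using assms(1) finite_same_card_bij[of "A - X" "A - Y"] by auto
  let ?g = "\<lambda>x. if x \<in> X then f x else h x"
  have "bij_betw ?g (X \<union> (A - X)) (Y \<union> (A - Y))"
    using assms(4) h by (intro bij_betw_disjoint_Un) auto
  then have "bij_betw ?g A A"
    using assms(2,3) by (simp add: Un_absorb1)
  then show thesis
    by (rule that) simp
qed

text \<open>Matching the entries of the two lists by index is a bijection between their sets, which
  extends to a permutation of \<open>A\<close>.\<close>

lemma Bij_k_transitive:
  assumes "finite A" "length xs = k" "distinct xs" "set xs \<subseteq> A"
    "length ys = k" "distinct ys" "set ys \<subseteq> A"
  shows "\<exists>g \<in> Bij A. \<forall>i < k. g (xs ! i) = ys ! i"
proof -
  have xs: "bij_betw ((!) xs) {..<k} (set xs)" and ys: "bij_betw ((!) ys) {..<k} (set ys)"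
    using assms by (auto intro: bij_betw_nth)
  let ?f = "(!) ys \<circ> inv_into {..<k} ((!) xs)"
  have "bij_betw ?f (set xs) (set ys)"
    using bij_betw_inv_into[OF xs] ys by (rule bij_betw_trans)
  then obtain g where g: "bij_betw g A A" and eq: "\<And>x. x \<in> set xs \<Longrightarrow> g x = ?f x"
    using bij_betw_extend_finite[of A "set xs" "set ys" ?f] assms by blast
  \<comment> \<open>\<open>Bij\<close> contains only functions that are extensional on
    \<open>A\<close>, hence the restriction.\<close>
  have "restrict g A \<in> Bij A"
    using g by (auto simp: Bij_def bij_betw_restrict_eq)
  moreover have "restrict g A (xs ! i) = ys ! i" if "i < k" for i
    using that assms(2,4) eq[of "xs ! i"] bij_betw_inv_into_left[OF xs, of i]
    by (auto simp: subset_iff)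
  ultimately show ?thesis by blast
qed

context quandle
begin

text \<open>Since \<open>y \<star> y = y\<close>, this is injectivity of right multiplication by
  \<open>y\<close>. It excludes the second factor as the value of a product of distinct
  elements.\<close>

lemma mult_eq_right_iff:
  assumes "x \<in> carrier Q" "y \<in> carrier Q"
  shows "x \<star> y = y \<longleftrightarrow> x = y"
  using inj_on_eq_iff[OF bij_betw_imp_inj_on[OF bij_right[OF assms(2)]] assms] idem[OF assms(2)]
  by simp

lemma quandle_AutoGroup_eq_iff:
  "quandle_AutoGroup Q = BijGroup (carrier Q) \<longleftrightarrow> Bij (carrier Q) \<subseteq> quandle_hom Q Q"
  by (auto simp: quandle_AutoGroup_def quandle_auto_def BijGroup_def)

text \<open>The group action is already established, so only the condition on lists remains.\<close>

lemma k_transitive_action_iff: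
  "k_transitive_action (quandle_AutoGroup Q) (carrier Q) (\<lambda>f. f) k \<longleftrightarrow>
    (\<forall>xs ys. length xs = k \<longrightarrow> distinct xs \<longrightarrow> set xs \<subseteq> carrier Q \<longrightarrow>
      length ys = k \<longrightarrow> distinct ys \<longrightarrow> set ys \<subseteq> carrier Q \<longrightarrow>
      (\<exists>g \<in> quandle_auto Q. \<forall>i < k. g (xs ! i) = ys ! i))"
  using group_action_quandle_AutoGroup
  by (auto simp: k_transitive_action_def k_transitive_action_axioms_def quandle_AutoGroup_def)

end

lemma card_3_eqI:
  assumes "card A = 3" "{a, b, c, d} \<subseteq> A" "a \<noteq> b" "c \<notin> {a, b}" "d \<notin> {a, b}"
  shows "c = d"
  using assms by (auto simp: card_3_iff)

text \<open>In both quandles the product of distinct elements is the third element, and a bijection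
  sends third element to third element. Taking \<open>R\<close> to be
  \<open>dihedral_quandle 3\<close> yields isomorphisms, taking it to be \<open>Q\<close> yields
  automorphisms.\<close>

lemma bij_betw_quandle_hom_card_3:
  assumes "quandle Q" "quandle R" "card (carrier Q) = 3"
    and Q: "\<And>x y. \<lbrakk>x \<in> carrier Q; y \<in> carrier Q; x \<star>\<^bsub>Q\<^esub> y = x\<rbrakk> \<Longrightarrow> x = y"
    and R: "\<And>x y. \<lbrakk>x \<in> carrier R; y \<in> carrier R; x \<star>\<^bsub>R\<^esub> y = x\<rbrakk> \<Longrightarrow> x = y"
    and h: "bij_betw h (carrier Q) (carrier R)"
  shows "h \<in> quandle_hom Q R"
proof -
  interpret Q: quandle Q by fact
  interpret R: quandle R by fact
  have mem: "h x \<in> carrier R" if "x \<in> carrier Q" for x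
    using h that by (auto simp: bij_betw_def)
  have inj: "h x = h y \<longleftrightarrow> x = y" if "x \<in> carrier Q" "y \<in> carrier Q" for x y
    using h that by (auto simp: bij_betw_def inj_on_eq_iff)
  have "h (x \<star>\<^bsub>Q\<^esub> y) = h x \<star>\<^bsub>R\<^esub> h y" if x: "x \<in> carrier Q" and y: "y \<in> carrier Q" for x y
  proof (cases "x = y")
    case True
    then show ?thesis using x mem by (simp add: Q.idem R.idem)
  next
    case False
    have "card (carrier R) = 3"
      using assms(3) h by (simp add: bij_betw_same_card)
    then show ?thesis
    proof (rule card_3_eqI)
      show "{h x, h y, h (x \<star>\<^bsub>Q\<^esub> y), h x \<star>\<^bsub>R\<^esub> h y} \<subseteq> carrier R"
        using x y by (simp add: mem Q.closed R.closed)
      show "h x \<noteq> h y" using False x y by (simp add: inj)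
      show "h (x \<star>\<^bsub>Q\<^esub> y) \<notin> {h x, h y}"
        using False x y Q[of x y] by (auto simp: inj Q.closed Q.mult_eq_right_iff)
      show "h x \<star>\<^bsub>R\<^esub> h y \<notin> {h x, h y}"
        using False x y R[of "h x" "h y"] by (auto simp: inj mem R.mult_eq_right_iff)
    qed
  qed
  then show ?thesis using mem by (auto simp: quandle_hom_def)
qed

text \<open>The equation says \<open>2 * (y - x) = 0\<close> modulo 3, where 2 is invertible; the
  proof checks all pairs.\<close>

lemma dihedral_quandle_3_mult_eq_left:
  assumes "x \<in> carrier (dihedral_quandle 3)" "y \<in> carrier (dihedral_quandle 3)"
    and "x \<star>\<^bsub>dihedral_quandle 3\<^esub> y = x"
  shows "x = y"
proof -
  have "x \<in> {0, 1, 2}" "y \<in> {0, 1, 2}"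
    using assms(1,2) by (auto simp: dihedral_quandle_def)
  then show ?thesis
    using assms(3) by (auto simp: dihedral_quandle_def)
qed

text \<open>This intrinsic description of the dihedral quandle on three elements replaces explicit
  isomorphisms in what follows.\<close>

lemma (in quandle) quandle_isomorphic_dihedral_3_iff:
  "quandle_isomorphic Q (dihedral_quandle 3) \<longleftrightarrow>
    card (carrier Q) = 3 \<and> (\<forall>x \<in> carrier Q. \<forall>y \<in> carrier Q. x \<star> y = x \<longrightarrow> x = y)"
    (is "?L \<longleftrightarrow> ?R")
proof
  assume ?L
  then obtain h where hom: "h \<in> quandle_hom Q (dihedral_quandle 3)"
    and h: "bij_betw h (carrier Q) (carrier (dihedral_quandle 3))"
    by (auto simp: quandle_isomorphic_def)
  have "card (carrier Q) = 3"
    using bij_betw_same_card[OF h] by (simp add: dihedral_quandle_def)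
  moreover have "x = y" if x: "x \<in> carrier Q" and y: "y \<in> carrier Q" and eq: "x \<star> y = x" for x y
  proof -
    have "h (x \<star> y) = h x \<star>\<^bsub>dihedral_quandle 3\<^esub> h y"
      using hom x y by (simp add: quandle_hom_def)
    then have "h x \<star>\<^bsub>dihedral_quandle 3\<^esub> h y = h x"
      by (simp only: eq)
    then have "h x = h y"
      using dihedral_quandle_3_mult_eq_left h x y by (meson bij_betwE)
    then show ?thesis
      using h x y by (auto simp: bij_betw_def inj_on_eq_iff)
  qed
  ultimately show ?R by blast
next
  assume R: ?R
  \<comment> \<open>An infinite set has \<open>card\<close> equal to 0, not 3.\<close>
  then have "finite (carrier Q)"
    by (metis card.infinite zero_neq_numeral)
  then obtain h where h: "bij_betw h (carrier Q) (carrier (dihedral_quandle 3))"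
    using R finite_same_card_bij[of "carrier Q" "carrier (dihedral_quandle 3)"]
    by (auto simp: dihedral_quandle_def)
  have "h \<in> quandle_hom Q (dihedral_quandle 3)"
    using R h quandle_dihedral[of 3] dihedral_quandle_3_mult_eq_left
    by (intro bij_betw_quandle_hom_card_3) (auto simp: quandle_axioms)
  with h show ?L by (auto simp: quandle_isomorphic_def)
qed

lemma (in quandle) trivial_or_dihedral_3_if_3_transitive:
  assumes "k_transitive_action (quandle_AutoGroup Q) (carrier Q) (\<lambda>f. f) 3"
  shows "trivial_quandle Q \<or> quandle_isomorphic Q (dihedral_quandle 3)"
proof (cases "trivial_quandle Q")
  case False
  then obtain x y where x: "x \<in> carrier Q" and y: "y \<in> carrier Q" and ne: "y \<star> x \<noteq> y"
    by (auto simp: trivial_quandle_def trivial_quandle_axioms_def quandle_axioms)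
  define z where "z = y \<star> x"
  have xy: "y \<noteq> x" using ne idem[OF x] by auto
  have z: "z \<in> carrier Q" "z \<noteq> x" "z \<noteq> y"
    using x y ne xy by (auto simp: z_def closed mult_eq_right_iff)
  have trans: "\<exists>g \<in> quandle_auto Q. g a = a' \<and> g b = b' \<and> g c = c'"
    \<comment> \<open>The list form of 3-transitivity, restated for explicit triples.\<close>
    if "distinct [a, b, c]" "{a, b, c} \<subseteq> carrier Q"
      "distinct [a', b', c']" "{a', b', c'} \<subseteq> carrier Q" for a b c a' b' c'
  proof -
    have "\<exists>g \<in> quandle_auto Q. \<forall>i < 3. g ([a, b, c] ! i) = [a', b', c'] ! i"
      by (rule assms[unfolded k_transitive_action_iff, rule_format]) (use that in auto)
    then obtain g where "g \<in> quandle_auto Q" "\<forall>i < 3. g ([a, b, c] ! i) = [a', b', c'] ! i"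
      by blast
    then show ?thesis
      by (intro bexI[of _ g]) (auto simp: numeral_3_eq_3 All_less_Suc2)
  qed
  have hom: "g (a \<star> b) = g a \<star> g b"
    if "g \<in> quandle_auto Q" "a \<in> carrier Q" "b \<in> carrier Q" for g a b
    using that by (auto simp: quandle_auto_def quandle_hom_def)
  have carrier: "carrier Q = {x, y, z}"
  proof (rule ccontr)
    assume "carrier Q \<noteq> {x, y, z}"
    then obtain w where w: "w \<in> carrier Q" "w \<notin> {x, y, z}"
      using x y z by auto
    \<comment> \<open>Moving \<open>z\<close> to a fourth element \<open>w\<close> while fixing
      \<open>x\<close> and \<open>y\<close> is impossible, because \<open>z\<close> is the product
      \<open>y \<star> x\<close>.\<close>
    then obtain g where "g \<in> quandle_auto Q" "g x = x" "g y = y" "g z = w"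
      using trans[of x y z x y w] x y z xy by auto
    then have "w = z"
      using hom[of g y x] x y by (simp add: z_def)
    with w show False by simp
  qed
  then have card: "card (carrier Q) = 3"
    using xy z by simp
  have "a = b" if a: "a \<in> carrier Q" and b: "b \<in> carrier Q" and eq: "a \<star> b = a" for a b
  proof (rule ccontr)
    assume ab: "a \<noteq> b"
    \<comment> \<open>The element \<open>c\<close> completes \<open>a\<close>, \<open>b\<close> to a
      triple, as 3-transitivity requires. The resulting \<open>g\<close> would turn
      \<open>a \<star> b = a\<close> into \<open>y \<star> x = y\<close>, against the choice of
      \<open>x\<close> and \<open>y\<close>.\<close>
    obtain c where c: "c \<in> carrier Q" "c \<noteq> a" "c \<noteq> b"
      using carrier xy z by (metis insertCI)
    obtain g where "g \<in> quandle_auto Q" "g a = y" "g b = x"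
      using trans[of a b c y x z] a b c ab x y z xy by auto
    then show False
      using hom[of g a b] a b eq ne by simp
  qed
  with card show ?thesis
    by (simp add: quandle_isomorphic_dihedral_3_iff)
qed simp

theorem theorem6p2:
  fixes Q :: "('a, 'c) quandle_struct_scheme"
  assumes "finite_quandle Q"
  shows "((trivial_quandle Q \<or> quandle_isomorphic Q (dihedral_quandle 3)) \<longleftrightarrow>
          quandle_AutoGroup Q = BijGroup (carrier Q)) \<and>
         (quandle_AutoGroup Q = BijGroup (carrier Q) \<longleftrightarrow>
          k_transitive_action (quandle_AutoGroup Q) (carrier Q) (\<lambda>f. f) 3)"
proof -
  interpret finite_quandle Q by fact
  have "quandle_AutoGroup Q = BijGroup (carrier Q)" if "trivial_quandle Q"
  proof -
    interpret trivial_quandle Q by fact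
    have "f (x \<star>\<^bsub>Q\<^esub> y) = f x \<star>\<^bsub>Q\<^esub> f y"
      if "f \<in> Bij (carrier Q)" "x \<in> carrier Q" "y \<in> carrier Q" for f x y
      using that funcset_mem[OF Bij_imp_funcset[OF that(1)]] by (simp add: trivial)
    then show ?thesis
      by (auto simp: quandle_AutoGroup_eq_iff quandle_hom_def dest: Bij_imp_funcset)
  qed
  moreover have "quandle_AutoGroup Q = BijGroup (carrier Q)"
    if "quandle_isomorphic Q (dihedral_quandle 3)"
    \<comment> \<open>Every permutation is a bijection from \<open>Q\<close> to itself, so the
      three-element lemma applies with both quandles equal to \<open>Q\<close>.\<close>
    using that unfolding quandle_isomorphic_dihedral_3_iff quandle_AutoGroup_eq_iff
    by (auto simp: Bij_def quandle_axioms intro!: bij_betw_quandle_hom_card_3)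
  moreover have "k_transitive_action (quandle_AutoGroup Q) (carrier Q) (\<lambda>f. f) 3"
    if "quandle_AutoGroup Q = BijGroup (carrier Q)"
  proof -
    have "quandle_auto Q = Bij (carrier Q)"
      using that by (auto simp: quandle_AutoGroup_eq_iff quandle_auto_def)
    then show ?thesis
      by (simp add: k_transitive_action_iff Bij_k_transitive finite_carrier)
  qed
  \<comment> \<open>The implications form a cycle: the classification gives all permutations, these
    give 3-transitivity, and that gives the classification.\<close>
  ultimately show ?thesis
    using trivial_or_dihedral_3_if_3_transitive by blast
qed

end
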